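(* Let $M$ be a proper metric space, $K$ be a compactification, $X$ be the set of isolated points of $K$, and $(X,\mathcal E_{X,K})$ be the permutation coarse space of $K$. The space $K$ is $M$-equivalent to the $M$-compactification $h_M(X,\mathcal E_{X,K})$ of the coarse space $(X,\mathcal E_{X,K})$ if and only if $K$ is $M$-soft.
   Context: An entourage on a set $X$ is a subset $E\subseteq X\times X$ containing the diagonal $\Delta_X$; $E^{-1}=\{(y,x):(x,y)\in E\}$, $E\circ F=\{(x,z):\exists y\in X,\ (x,y)\in E,\ (y,z)\in F\}$, $E[x]=\{y\in X:(x,y)\in E\}$. A coarse space $(X,\mathcal E)$ is a set $X$ with a family $\mathcal E$ of entourages (its coarse structure) such that $\bigcup\mathcal E=X\times X$; for all $E,F\in\mathcal E$ there is $G\in\mathcal E$ with $E\circ F^{-1}\subseteq G$; and $\Delta_X\subseteq E\subseteq F\in\mathcal E$ implies $E\in\mathcal E$. A set $B\subseteq X$ is bounded if $B\subseteq E[x]$ for some $E\in\mathcal E$, $x\in X$. A metric space $(M,d_M)$ is proper if $|M|\ge 2$ and each closed bounded set in $M$ is compact. A function $\varphi:X\to M$ is slowly oscillating if for every $\varepsilon>0$ and $E\in\mathcal E$ there is a bounded set $B\subseteq X$ with $\mathrm{diam}\,\varphi(E[x])<\varepsilon$ for all $x\in X\setminus B$. Let $\mathsf{so}(X,\mathcal E;M)$ be the set of all bounded slowly oscillating functions $X\to M$. The $M$-compactification $h_M(X,\mathcal E)$ is the closure of the image of the injective map $X\to M^{\mathsf{so}(X,\mathcal E;M)}$, $x\mapsto(f(x))_f$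 (product topology); it is compact Hausdorff. $X$ is identified with its image, and it is then the set of isolated points of $h_M(X,\mathcal E)$. A compactification is a compact Hausdorff space $K$ whose set $K'$ of isolated points is dense in $K$. Two compactifications $K_1,K_2$ with the same set $X=K_1'=K_2'$ of isolated points are $M$-equivalent if $\mathsf{uc}(X,K_1;M)=\mathsf{uc}(X,K_2;M)$, where $\mathsf{uc}(X,K;M)=\{f{\restriction}X: f:K\to M\text{ continuous}\}$. For a compact Hausdorff space $K$ with set $X$ of isolated points, $\mathcal H(K,X)$ is the group of homeomorphisms $g$ of $K$ with $g(x)=x$ for all $x\in K\setminus X$, and $G_{X,K}=\{g{\restriction}X:g\in\mathcal H(K,X)\}$. The permutation coarse space of $K$ is $(X,\mathcal E_{X,K})$, where $\mathcal E_{X,K}$ consists of all entourages on $X$ contained in $\{(x,y)\in X\times X:y\in\{x\}\cup\{g(x):g\in F\}\}$ for some finite $F\subseteq G_{X,K}$. For a function $\varphi:K'\to M$ and $z\in K$, $\mathrm{osc}_z(\varphi)=\inf\{\mathrm{diam}\,\varphi(K'\cap O_z): O_z \text{ an open neighborhood of } z \text{ in } K\}$. A compactification $K$ is $M$-soft if for any bounded function $\varphi:K'\to M$ with $\{z\in K:\mathrm{osc}_z(\varphi)>0\}\neq\emptyset$ there exist $g\in\mathcal H(K,K')$ and $\varepsilon>0$ such that $d_M(\varphi(g(x)),\varphi(x))\ge\varepsilon$ for infinitely many $x\in K'$. *)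

theory Defs
  imports "HOL-Analysis.Analysis"
begin

section \<open>Coarse spaces\<close>

definition entourage :: "'a set \<Rightarrow> 'a rel \<Rightarrow> bool" where
  "entourage X E \<longleftrightarrow> Id_on X \<subseteq> E \<and> E \<subseteq> X \<times> X"

definition coarse_space :: "'a set \<Rightarrow> 'a rel set \<Rightarrow> bool" where
  "coarse_space X \<E> \<longleftrightarrow>
     (\<forall>E\<in>\<E>. entourage X E) \<and>
     \<Union>\<E> = X \<times> X \<and>
     (\<forall>E\<in>\<E>. \<forall>F\<in>\<E>. \<exists>G\<in>\<E>. E O F\<inverse> \<subseteq> G) \<and>
     (\<forall>E F. Id_on X \<subseteq> E \<and> E \<subseteq> F \<and> F \<in> \<E> \<longrightarrow> E \<in> \<E>)"

definition coarse_bounded :: "'a set \<Rightarrow> 'a rel set \<Rightarrow> 'a set \<Rightarrow> bool" where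
  "coarse_bounded X \<E> B \<longleftrightarrow> B \<subseteq> X \<and> (\<exists>E\<in>\<E>. \<exists>x\<in>X. B \<subseteq> E `` {x})"

text \<open>
  The library's \<^const>\<open>diameter\<close> is real-valued and carries no information about unbounded
  sets, so a finite diameter is expressed by requiring boundedness in addition.
\<close>

definition slowly_oscillating ::
    "'a set \<Rightarrow> 'a rel set \<Rightarrow> ('a \<Rightarrow> 'm::metric_space) \<Rightarrow> bool" where
  "slowly_oscillating X \<E> \<phi> \<longleftrightarrow>
     (\<forall>\<epsilon>>0. \<forall>E\<in>\<E>. \<exists>B. coarse_bounded X \<E> B \<and>
        (\<forall>x\<in>X - B. bounded (\<phi> ` (E `` {x})) \<and> diameter (\<phi> ` (E `` {x})) < \<epsilon>))"

text \<open>Functions defined on \<open>X\<close> only are represented by elements of \<^term>\<open>extensional X\<close>.\<close>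

definition so :: "'a set \<Rightarrow> 'a rel set \<Rightarrow> ('a \<Rightarrow> 'm::metric_space) set" where
  "so X \<E> = {\<phi> \<in> extensional X. bounded (\<phi> ` X) \<and> slowly_oscillating X \<E> \<phi>}"

definition so_embedding ::
    "'a set \<Rightarrow> 'a rel set \<Rightarrow> 'a \<Rightarrow> (('a \<Rightarrow> 'm::metric_space) \<Rightarrow> 'm)" where
  "so_embedding X \<E> x = (\<lambda>f\<in>so X \<E>. f x)"

definition M_compactification ::
    "'a set \<Rightarrow> 'a rel set \<Rightarrow> (('a \<Rightarrow> 'm::metric_space) \<Rightarrow> 'm) topology" where
  "M_compactification X \<E> =
     (let P = product_topology (\<lambda>_. euclidean) (so X \<E>)
      in subtopology P (P closure_of (so_embedding X \<E> ` X)))"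

section \<open>Proper metric spaces\<close>

definition proper_metric :: "'m::metric_space itself \<Rightarrow> bool" where
  "proper_metric _ \<longleftrightarrow>
     (\<exists>x y::'m. x \<noteq> y) \<and> (\<forall>S::'m set. closed S \<and> bounded S \<longrightarrow> compact S)"

section \<open>Compactifications and their equivalence\<close>

definition isolated_points :: "'a topology \<Rightarrow> 'a set" where
  "isolated_points K = {x \<in> topspace K. openin K {x}}"

definition compactification :: "'a topology \<Rightarrow> bool" where
  "compactification K \<longleftrightarrow>
     compact_space K \<and> Hausdorff_space K \<and> K closure_of isolated_points K = topspace K"

text \<open>
  The points of the \<open>M\<close>-compactification are functions, so \<open>X\<close> is not literally its set of
  isolated points but only identified with it. Such identifications are kept explicit: two
  compactifications \<open>K\<^sub>1\<close>, \<open>K\<^sub>2\<close> ``with the same set \<open>X\<close> of isolated points'' come with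
  bijections \<open>e\<^sub>1\<close>, \<open>e\<^sub>2\<close> from \<open>X\<close> onto their sets of isolated points, and restriction to \<open>X\<close>
  means composition with these.
\<close>

definition compactification_of :: "'x set \<Rightarrow> 'a topology \<Rightarrow> ('x \<Rightarrow> 'a) \<Rightarrow> bool" where
  "compactification_of X K e \<longleftrightarrow> compactification K \<and> bij_betw e X (isolated_points K)"

definition uc :: "'x set \<Rightarrow> 'a topology \<Rightarrow> ('x \<Rightarrow> 'a) \<Rightarrow> ('x \<Rightarrow> 'm::metric_space) set" where
  "uc X K e = {restrict (f \<circ> e) X | f. continuous_map K euclidean f}"

definition M_equivalent ::
    "'m::metric_space itself \<Rightarrow> 'x set \<Rightarrow>
     'a topology \<Rightarrow> ('x \<Rightarrow> 'a) \<Rightarrow> 'b topology \<Rightarrow> ('x \<Rightarrow> 'b) \<Rightarrow> bool" where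
  "M_equivalent _ X K\<^sub>1 e\<^sub>1 K\<^sub>2 e\<^sub>2 \<longleftrightarrow>
     compactification_of X K\<^sub>1 e\<^sub>1 \<and> compactification_of X K\<^sub>2 e\<^sub>2 \<and>
     (uc X K\<^sub>1 e\<^sub>1 :: ('x \<Rightarrow> 'm) set) = uc X K\<^sub>2 e\<^sub>2"

section \<open>The permutation coarse space\<close>

definition homeo_fixing :: "'a topology \<Rightarrow> 'a set \<Rightarrow> ('a \<Rightarrow> 'a) set" where
  "homeo_fixing K X =
     {g \<in> extensional (topspace K). homeomorphic_map K K g \<and> (\<forall>x\<in>topspace K - X. g x = x)}"

definition perm_group :: "'a set \<Rightarrow> 'a topology \<Rightarrow> ('a \<Rightarrow> 'a) set" where
  "perm_group X K = (\<lambda>g. restrict g X) ` homeo_fixing K X"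

definition orbit_entourage :: "'a set \<Rightarrow> ('a \<Rightarrow> 'a) set \<Rightarrow> 'a rel" where
  "orbit_entourage X F = {(x, y) \<in> X \<times> X. y \<in> {x} \<union> {g x | g. g \<in> F}}"

definition perm_coarse :: "'a set \<Rightarrow> 'a topology \<Rightarrow> 'a rel set" where
  "perm_coarse X K =
     {E. entourage X E \<and> (\<exists>F. finite F \<and> F \<subseteq> perm_group X K \<and> E \<subseteq> orbit_entourage X F)}"

section \<open>Soft compactifications\<close>

text \<open>
  Only bounded \<open>\<phi>\<close> matter below; for these all the diameters, and hence the infimum, are
  finite (and the set of diameters is nonempty when \<open>z\<close> is a point of \<open>K\<close>).
\<close>

definition osc :: "'a topology \<Rightarrow> ('a \<Rightarrow> 'm::metric_space) \<Rightarrow> 'a \<Rightarrow> real" where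
  "osc K \<phi> z = Inf {diameter (\<phi> ` (isolated_points K \<inter> U)) | U. openin K U \<and> z \<in> U}"

definition M_soft :: "'m::metric_space itself \<Rightarrow> 'a topology \<Rightarrow> bool" where
  "M_soft _ K \<longleftrightarrow>
     compactification K \<and>
     (\<forall>\<phi> :: 'a \<Rightarrow> 'm.
        bounded (\<phi> ` isolated_points K) \<and> {z \<in> topspace K. osc K \<phi> z > 0} \<noteq> {} \<longrightarrow>
        (\<exists>g\<in>homeo_fixing K (isolated_points K). \<exists>\<epsilon>>0.
           infinite {x \<in> isolated_points K. dist (\<phi> (g x)) (\<phi> x) \<ge> \<epsilon>}))"

section \<open>The permutation coarse space is a coarse space\<close>

lemma id_homeo_fixing: "restrict (\<lambda>x. x) (topspace K) \<in> homeo_fixing K X"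
proof -
  have "homeomorphic_map K K id"
    by (simp add: homeomorphic_map_id)
  then have "homeomorphic_map K K (restrict (\<lambda>x. x) (topspace K))"
    by (rule homeomorphic_map_eq) auto
  then show ?thesis
    by (auto simp: homeo_fixing_def)
qed

lemma quotient_homeo_fixing:
  assumes "g \<in> homeo_fixing K X" "h \<in> homeo_fixing K X" and X: "X \<subseteq> topspace K"
  obtains k where "k \<in> homeo_fixing K X" "\<And>x z. x \<in> X \<Longrightarrow> z \<in> X \<Longrightarrow> h z = g x \<Longrightarrow> k x = z"
proof -
  have g: "homeomorphic_map K K g" "\<And>x. x \<in> topspace K - X \<Longrightarrow> g x = x"
    and h: "homeomorphic_map K K h" "\<And>x. x \<in> topspace K - X \<Longrightarrow> h x = x"
    using assms by (auto simp: homeo_fixing_def)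
  obtain h' where h': "homeomorphic_maps K K h h'"
    using h(1) homeomorphic_map_maps by blast
  have inv: "\<And>x. x \<in> topspace K \<Longrightarrow> h' (h x) = x" and "homeomorphic_map K K h'"
    using h' homeomorphic_maps_map by (auto simp: homeomorphic_maps_def)
  define k where "k = restrict (h' \<circ> g) (topspace K)"
  have "homeomorphic_map K K (h' \<circ> g)"
    using \<open>homeomorphic_map K K h'\<close> g(1) homeomorphic_map_compose by blast
  then have "homeomorphic_map K K k"
    by (rule homeomorphic_map_eq) (auto simp: k_def)
  moreover have "k x = x" if "x \<in> topspace K - X" for x
    using that g(2)[OF that] h(2)[OF that] inv[of x] by (auto simp: k_def)
  ultimately have "k \<in> homeo_fixing K X"
    by (auto simp: homeo_fixing_def k_def)
  moreover have "k x = z" if "x \<in> X" "z \<in> X" "h z = g x" for x z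
    using that X inv[of z] by (auto simp: k_def)
  ultimately show thesis
    using that by blast
qed

lemma transpose_homeo_fixing:
  assumes K: "Hausdorff_space K" and ab: "a \<in> isolated_points K" "b \<in> isolated_points K"
  shows "restrict (Transposition.transpose a b) (topspace K) \<in> homeo_fixing K (isolated_points K)"
proof -
  have op: "openin K {a}" "openin K {b}" and top: "a \<in> topspace K" "b \<in> topspace K"
    using ab by (auto simp: isolated_points_def)
  have "continuous_map K K (Transposition.transpose a b)"
    unfolding continuous_map_def
  proof (intro conjI allI impI)
    show "Transposition.transpose a b \<in> topspace K \<rightarrow> topspace K"
      using top by (auto simp: Transposition.transpose_def)
    fix U assume U: "openin K U"
    have "closedin K {a, b}"
      using K top by (intro closedin_Hausdorff_finite) auto
    then have 1: "openin K (U - {a, b})"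
      using U by blast
    have 2: "openin K (if b \<in> U then {a} else {})" "openin K (if a \<in> U then {b} else {})"
      using op by auto
    have "{x \<in> topspace K. Transposition.transpose a b x \<in> U} =
        (U - {a, b}) \<union> ((if b \<in> U then {a} else {}) \<union> (if a \<in> U then {b} else {}))"
      using top openin_subset[OF U]
      by (cases "a \<in> U"; cases "b \<in> U") (auto simp: Transposition.transpose_def)
    then show "openin K {x \<in> topspace K. Transposition.transpose a b x \<in> U}"
      using openin_Un[OF 1 openin_Un[OF 2]] by simp
  qed
  then have "homeomorphic_maps K K (Transposition.transpose a b) (Transposition.transpose a b)"
    by (auto simp: homeomorphic_maps_def)
  then have "homeomorphic_map K K (Transposition.transpose a b)"
    using homeomorphic_map_maps by blast
  then have "homeomorphic_map K K (restrict (Transposition.transpose a b) (topspace K))"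
    by (rule homeomorphic_map_eq) auto
  then show ?thesis
    using ab by (auto simp: homeo_fixing_def Transposition.transpose_def)
qed

lemma coarse_space_perm_coarse:
  assumes K: "Hausdorff_space K"
  shows "coarse_space (isolated_points K) (perm_coarse (isolated_points K) K)"
proof -
  define X where "X = isolated_points K"
  have X: "X \<subseteq> topspace K"
    by (auto simp: X_def isolated_points_def)
  have orbit: "orbit_entourage X F \<in> perm_coarse X K"
    if "finite F" "F \<subseteq> perm_group X K" for F
    using that unfolding perm_coarse_def
    by (auto simp: entourage_def orbit_entourage_def)
  have union: "\<Union>(perm_coarse X K) = X \<times> X"
  proof
    show "\<Union>(perm_coarse X K) \<subseteq> X \<times> X"
      by (auto simp: perm_coarse_def entourage_def)
    show "X \<times> X \<subseteq> \<Union>(perm_coarse X K)"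
    proof clarify
      fix a b assume ab: "a \<in> X" "b \<in> X"
      let ?t = "restrict (restrict (Transposition.transpose a b) (topspace K)) X"
      have "?t \<in> perm_group X K"
        unfolding perm_group_def using transpose_homeo_fixing[OF K ab[unfolded X_def]]
        by (intro imageI) (simp only: X_def)
      moreover have "(a, b) \<in> orbit_entourage X {?t}"
        using ab X by (auto simp: orbit_entourage_def)
      ultimately show "(a, b) \<in> \<Union>(perm_coarse X K)"
        using orbit[of "{?t}"] by auto
    qed
  qed
  have comp: "\<exists>G\<in>perm_coarse X K. E O F\<inverse> \<subseteq> G"
    if E: "E \<in> perm_coarse X K" and F: "F \<in> perm_coarse X K" for E F
  proof -
    define i where "i = restrict (\<lambda>x. x) (topspace K)"
    have ext: "\<exists>H. finite H \<and> H \<subseteq> homeo_fixing K X \<and>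
        (\<forall>(x, y)\<in>D. x \<in> X \<and> y \<in> X \<and> (\<exists>g\<in>H. y = g x))" if "D \<in> perm_coarse X K" for D
    proof -
      from that obtain F where F: "finite F" "F \<subseteq> perm_group X K" "D \<subseteq> orbit_entourage X F"
        by (auto simp: perm_coarse_def)
      then obtain H where H: "finite H" "H \<subseteq> homeo_fixing K X" "F = (\<lambda>g. restrict g X) ` H"
        unfolding perm_group_def by (meson finite_subset_image)
      have "\<forall>(x, y)\<in>D. x \<in> X \<and> y \<in> X \<and> (\<exists>g\<in>insert i H. y = g x)"
      proof clarify
        fix x y assume "(x, y) \<in> D"
        then have "(x, y) \<in> orbit_entourage X ((\<lambda>g. restrict g X) ` H)"
          using F(3) H(3) by blast
        then have xy: "x \<in> X" "y \<in> X" and "y = x \<or> (\<exists>g\<in>H. y = restrict g X x)"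
          unfolding orbit_entourage_def by auto
        moreover have "i x = x"
          using xy X by (auto simp: i_def)
        ultimately show "x \<in> X \<and> y \<in> X \<and> (\<exists>g\<in>insert i H. y = g x)"
          by auto
      qed
      moreover have "insert i H \<subseteq> homeo_fixing K X"
        using H(2) id_homeo_fixing[of K X] by (auto simp: i_def)
      ultimately show ?thesis
        using H(1) by (intro exI[of _ "insert i H"]) simp
    qed
    obtain H1 where H1: "finite H1" "H1 \<subseteq> homeo_fixing K X"
        "\<forall>(x, y)\<in>E. x \<in> X \<and> y \<in> X \<and> (\<exists>g\<in>H1. y = g x)"
      using ext[OF E] by blast
    obtain H2 where H2: "finite H2" "H2 \<subseteq> homeo_fixing K X"
        "\<forall>(x, y)\<in>F. x \<in> X \<and> y \<in> X \<and> (\<exists>g\<in>H2. y = g x)"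
      using ext[OF F] by blast
    have "\<forall>p\<in>H1 \<times> H2. \<exists>k\<in>homeo_fixing K X.
        \<forall>x\<in>X. \<forall>z\<in>X. snd p z = fst p x \<longrightarrow> k x = z"
    proof
      fix p assume "p \<in> H1 \<times> H2"
      then have "fst p \<in> homeo_fixing K X" "snd p \<in> homeo_fixing K X"
        using H1(2) H2(2) by auto
      then show "\<exists>k\<in>homeo_fixing K X. \<forall>x\<in>X. \<forall>z\<in>X. snd p z = fst p x \<longrightarrow> k x = z"
        by (rule quotient_homeo_fixing[OF _ _ X]) blast
    qed
    then obtain q where q: "\<And>p. p \<in> H1 \<times> H2 \<Longrightarrow> q p \<in> homeo_fixing K X"
        "\<And>p x z. p \<in> H1 \<times> H2 \<Longrightarrow> x \<in> X \<Longrightarrow> z \<in> X \<Longrightarrow> snd p z = fst p x \<Longrightarrow> q p x = z"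
      by metis
    define F3 where "F3 = (\<lambda>p. restrict (q p) X) ` (H1 \<times> H2)"
    have "finite F3" "F3 \<subseteq> perm_group X K"
      using H1(1) H2(1) q(1) by (auto simp: F3_def perm_group_def)
    moreover have "E O F\<inverse> \<subseteq> orbit_entourage X F3"
    proof clarify
      fix x y z assume "(x, y) \<in> E" "(z, y) \<in> F"
      then obtain g h where "x \<in> X" "z \<in> X" and gh: "g \<in> H1" "h \<in> H2" "y = g x" "y = h z"
        using H1(3) H2(3) by blast
      then have "z = restrict (q (g, h)) X x"
        using q(2)[of "(g, h)" x z] by auto
      moreover have "restrict (q (g, h)) X \<in> F3"
        using gh by (auto simp: F3_def)
      ultimately show "(x, z) \<in> orbit_entourage X F3"
        using \<open>x \<in> X\<close> \<open>z \<in> X\<close> unfolding orbit_entourage_def by blast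
    qed
    ultimately show ?thesis
      using orbit by blast
  qed
  show ?thesis
    unfolding coarse_space_def X_def[symmetric]
  proof (intro conjI allI impI)
    show "\<forall>E\<in>perm_coarse X K. entourage X E"
      by (simp add: perm_coarse_def)
    show "\<forall>E\<in>perm_coarse X K. \<forall>F\<in>perm_coarse X K. \<exists>G\<in>perm_coarse X K. E O F\<inverse> \<subseteq> G"
      using comp by blast
    fix E F assume "Id_on X \<subseteq> E \<and> E \<subseteq> F \<and> F \<in> perm_coarse X K"
    then have E: "Id_on X \<subseteq> E" "E \<subseteq> F" and "F \<in> perm_coarse X K"
      by auto
    then obtain A where A: "F \<subseteq> X \<times> X" "finite A" "A \<subseteq> perm_group X K" "F \<subseteq> orbit_entourage X A"
      unfolding perm_coarse_def entourage_def by blast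
    then show "E \<in> perm_coarse X K"
      unfolding perm_coarse_def entourage_def
      using E order_trans[OF E(2) A(1)] order_trans[OF E(2) A(4)] by blast
  qed (rule union)
qed

end

theory Submission
  imports Defs
begin

text \<open>
  For every nonempty coarse space the bounded slowly oscillating functions are exactly the functions
  that extend continuously to the \<open>M\<close>-compactification (\<open>uc_M_compactification\<close>). Hence, if \<open>X\<close> is
  nonempty, \<open>K\<close> is \<open>M\<close>-equivalent to \<open>h\<^sub>M\<close> of its permutation coarse space if and only if the
  bounded slowly oscillating functions on \<open>X\<close> are exactly those that extend continuously to \<open>K\<close>.

  In the permutation coarse space the bounded sets are the finite ones, so a function \<open>\<phi>\<close> oscillates
  slowly if and only if, for every \<open>\<epsilon> > 0\<close>, each \<open>g\<close> of the permutation group moves the values of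
  \<open>\<phi>\<close> by \<open>\<epsilon>\<close> or more at finitely many points only (\<open>slowly_oscillating_perm_coarse_iff\<close>). A function
  that is continuous on all of \<open>K\<close> has this property by compactness, because \<open>g\<close> fixes every
  non-isolated point (\<open>uc_subset_so_perm_coarse\<close>). So one inclusion is always true, and only the
  other one, that every bounded slowly oscillating function extends, is a condition on \<open>K\<close>. Since
  \<open>M\<close> is proper, a bounded function extends if and only if its oscillation vanishes at every point
  (\<open>restrict_in_uc_iff_osc_le_0\<close>). After these two translations, softness is the contrapositive of
  that remaining inclusion (\<open>M_soft_iff_so_subset_uc\<close>).

  The empty space is treated apart: it has no bounded sets, hence no slowly oscillating functions,
  although the empty function extends continuously.
\<close>

section \<open>Functions into metric spaces\<close>

lemma continuous_map_metric_iff: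
  fixes f :: "'a \<Rightarrow> 'm::metric_space"
  shows "continuous_map T euclidean f \<longleftrightarrow>
    (\<forall>x\<in>topspace T. \<forall>\<epsilon>>0. \<exists>U. openin T U \<and> x \<in> U \<and> (\<forall>y\<in>U. dist (f x) (f y) < \<epsilon>))"
  using Met_TC.continuous_map_to_metric[of T f] by simp

lemma continuous_map_dist:
  fixes f g :: "'a \<Rightarrow> 'm::metric_space"
  assumes f: "continuous_map T euclidean f" and g: "continuous_map T euclidean g"
  shows "continuous_map T euclideanreal (\<lambda>x. dist (f x) (g x))"
  unfolding continuous_map_metric_iff
proof (intro ballI allI impI)
  fix x and \<epsilon> :: real assume x: "x \<in> topspace T" and "\<epsilon> > 0"
  then have \<epsilon>: "\<epsilon> / 2 > 0" by simp
  obtain U where U: "openin T U" "x \<in> U" "\<And>y. y \<in> U \<Longrightarrow> dist (f x) (f y) < \<epsilon> / 2"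
    using f[unfolded continuous_map_metric_iff, rule_format, OF x \<epsilon>] by (elim exE conjE) simp
  obtain V where V: "openin T V" "x \<in> V" "\<And>y. y \<in> V \<Longrightarrow> dist (g x) (g y) < \<epsilon> / 2"
    using g[unfolded continuous_map_metric_iff, rule_format, OF x \<epsilon>] by (elim exE conjE) simp
  have "dist (dist (f x) (g x)) (dist (f y) (g y)) < \<epsilon>" if "y \<in> U \<inter> V" for y
  proof -
    have "\<bar>dist (f x) (g x) - dist (g x) (f y)\<bar> \<le> dist (f x) (f y)"
      "\<bar>dist (g x) (f y) - dist (f y) (g y)\<bar> \<le> dist (g x) (g y)"
      by (rule abs_dist_diff_le)+
    moreover have "dist (f x) (f y) < \<epsilon> / 2" "dist (g x) (g y) < \<epsilon> / 2"
      using U(3)[of y] V(3)[of y] that by auto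
    ultimately show ?thesis
      unfolding dist_real_def by linarith
  qed
  then show "\<exists>U. openin T U \<and> x \<in> U \<and>
      (\<forall>y\<in>U. dist (dist (f x) (g x)) (dist (f y) (g y)) < \<epsilon>)"
    using U(1,2) V(1,2) by (intro exI[of _ "U \<inter> V"] conjI ballI openin_Int IntI)
qed

lemma continuous_map_compact_space_bounded:
  fixes f :: "'a \<Rightarrow> 'm::metric_space"
  assumes "compact_space T" and "continuous_map T euclidean f" and "S \<subseteq> topspace T"
  shows "bounded (f ` S)"
proof -
  have "compact (f ` topspace T)"
    using image_compactin[OF _ assms(2)] assms(1) by (simp add: compact_space_def)
  then have "bounded (f ` topspace T)"
    by (rule compact_imp_bounded)
  then show ?thesis
    using image_mono[OF assms(3)] by (rule bounded_subset)
qed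

text \<open>
  A radius of \<open>\<epsilon> / 2\<close> would only bound the diameter by \<open>\<epsilon>\<close>; the radius \<open>\<epsilon> / 3\<close> makes the
  inequality strict.
\<close>

lemma diameter_less_of_near_point:
  fixes a :: "'m::metric_space"
  assumes "\<epsilon> > 0" and near: "\<And>y. y \<in> S \<Longrightarrow> dist a y \<le> \<epsilon> / 3"
  shows "bounded S \<and> diameter S < \<epsilon>"
proof
  show "bounded S"
    unfolding bounded_def by (intro exI[of _ a] exI[of _ "\<epsilon> / 3"] ballI near)
  have "dist x y \<le> 2 * \<epsilon> / 3" if "x \<in> S" "y \<in> S" for x y
    using near[OF that(1)] near[OF that(2)] dist_triangle3[of x y a] by linarith
  then have "(SUP (x, y)\<in>S \<times> S. dist x y) \<le> 2 * \<epsilon> / 3" if "S \<noteq> {}"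
    using that by (intro cSUP_least) auto
  then have "diameter S \<le> 2 * \<epsilon> / 3"
    using assms(1) by (simp add: diameter_def)
  then show "diameter S < \<epsilon>"
    using assms(1) by linarith
qed

lemma proper_metric_compact_closure:
  fixes S :: "'m::metric_space set"
  assumes "proper_metric TYPE('m)" and "bounded S"
  shows "compact (closure S)"
proof -
  have "\<forall>S :: 'm set. closed S \<and> bounded S \<longrightarrow> compact S"
    using assms(1) unfolding proper_metric_def by (rule conjunct2)
  from this[rule_format, of "closure S"] show ?thesis
    using bounded_closure[OF assms(2)] by simp
qed

section \<open>Bounded sets in a coarse space\<close>

lemma entourage_refl: "entourage X E \<Longrightarrow> x \<in> X \<Longrightarrow> (x, x) \<in> E"
  by (auto simp: entourage_def)

lemma coarse_space_entourage: "coarse_space X \<E> \<Longrightarrow> E \<in> \<E> \<Longrightarrow> entourage X E"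
  by (auto simp: coarse_space_def)

lemma coarse_space_mono:
  assumes X: "coarse_space X \<E>" and "F \<in> \<E>" "Id_on X \<subseteq> E" "E \<subseteq> F"
  shows "E \<in> \<E>"
proof -
  have "\<forall>E F. Id_on X \<subseteq> E \<and> E \<subseteq> F \<and> F \<in> \<E> \<longrightarrow> E \<in> \<E>"
    using X unfolding coarse_space_def by (elim conjE)
  from this[rule_format, of E F] show ?thesis
    using assms(2-4) by simp
qed

lemma coarse_space_relcomp_converse:
  "coarse_space X \<E> \<Longrightarrow> E \<in> \<E> \<Longrightarrow> F \<in> \<E> \<Longrightarrow> \<exists>G\<in>\<E>. E O F\<inverse> \<subseteq> G"
  by (simp add: coarse_space_def)

lemma coarse_space_converse:
  assumes X: "coarse_space X \<E>" and E: "E \<in> \<E>"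
  shows "E\<inverse> \<in> \<E>"
proof -
  have ent: "Id_on X \<subseteq> E" "E \<subseteq> X \<times> X"
    using coarse_space_entourage[OF X E] by (auto simp: entourage_def)
  have "Id_on X \<in> \<E>"
    using coarse_space_mono[OF X E subset_refl ent(1)] .
  then obtain G where G: "G \<in> \<E>" "Id_on X O E\<inverse> \<subseteq> G"
    using coarse_space_relcomp_converse[OF X _ E] by blast
  moreover have "Id_on X O E\<inverse> = E\<inverse>"
    using ent(2) by auto
  moreover have "Id_on X \<subseteq> E\<inverse>"
    using ent(1) by auto
  ultimately show ?thesis
    using coarse_space_mono[OF X G(1), of "E\<inverse>"] by simp
qed

lemma coarse_space_relcomp:
  assumes X: "coarse_space X \<E>" and E: "E \<in> \<E>" and F: "F \<in> \<E>"
  obtains G where "G \<in> \<E>" "E O F \<subseteq> G"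
proof -
  show thesis
    using coarse_space_relcomp_converse[OF X E coarse_space_converse[OF X F]] that by auto
qed

text \<open>
  Two balls around different points lie in a common ball because the coarse structure covers
  \<open>X \<times> X\<close>, so that some entourage joins the two centres.
\<close>

lemma coarse_bounded_Un:
  assumes X: "coarse_space X \<E>" and "coarse_bounded X \<E> A" and "coarse_bounded X \<E> B"
  shows "coarse_bounded X \<E> (A \<union> B)"
proof -
  obtain E x where E: "E \<in> \<E>" "x \<in> X" "A \<subseteq> E `` {x}" and "A \<subseteq> X"
    using assms(2) by (auto simp: coarse_bounded_def)
  obtain F y where F: "F \<in> \<E>" "y \<in> X" "B \<subseteq> F `` {y}" and "B \<subseteq> X"
    using assms(3) by (auto simp: coarse_bounded_def)
  have "(x, y) \<in> \<Union>\<E>"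
    using X E(2) F(2) by (auto simp: coarse_space_def)
  then obtain D where D: "D \<in> \<E>" "(x, y) \<in> D"
    by blast
  obtain G where G: "G \<in> \<E>" "D O F \<subseteq> G"
    using coarse_space_relcomp[OF X D(1) F(1)] .
  obtain H where H: "H \<in> \<E>" "E O G \<subseteq> H"
    using coarse_space_relcomp[OF X E(1) G(1)] .
  have "a \<in> H `` {x}" if "a \<in> A" for a
  proof -
    have "(a, a) \<in> G"
      using entourage_refl[OF coarse_space_entourage[OF X G(1)]] that \<open>A \<subseteq> X\<close> by blast
    then show ?thesis
      using that E(3) H(2) by blast
  qed
  moreover have "b \<in> H `` {x}" if "b \<in> B" for b
  proof -
    have "(x, x) \<in> E"
      using entourage_refl[OF coarse_space_entourage[OF X E(1)] E(2)] .
    moreover have "(x, b) \<in> G"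
      using that F(3) D(2) G(2) by blast
    ultimately show ?thesis
      using H(2) by blast
  qed
  ultimately have "A \<union> B \<subseteq> H `` {x}"
    by blast
  then show ?thesis
    using H(1) E(2) \<open>A \<subseteq> X\<close> \<open>B \<subseteq> X\<close> by (auto simp: coarse_bounded_def)
qed

lemma coarse_bounded_empty: "coarse_space X \<E> \<Longrightarrow> X \<noteq> {} \<Longrightarrow> coarse_bounded X \<E> {}"
  unfolding coarse_space_def coarse_bounded_def by (cases "\<E> = {}") auto

lemma coarse_bounded_UN:
  assumes X: "coarse_space X \<E>" "X \<noteq> {}" and "finite I"
    and "\<And>i. i \<in> I \<Longrightarrow> coarse_bounded X \<E> (B i)"
  shows "coarse_bounded X \<E> (\<Union>i\<in>I. B i)"
  using assms(3,4)
  by (induction I rule: finite_induct)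
    (auto simp: coarse_bounded_empty[OF X] intro!: coarse_bounded_Un[OF X(1)])

section \<open>The M-compactification of a coarse space\<close>

lemma topspace_M_compactification:
  "topspace (M_compactification X \<E> :: (('a \<Rightarrow> 'm::metric_space) \<Rightarrow> 'm) topology) =
    product_topology (\<lambda>_. euclidean) (so X \<E>) closure_of (so_embedding X \<E> ` X)"
  unfolding M_compactification_def Let_def topspace_subtopology
  using closure_of_subset_topspace by fastforce

lemma continuous_map_M_compactification_coordinate:
  fixes f :: "'a \<Rightarrow> 'm::metric_space"
  assumes "f \<in> so X \<E>"
  shows "continuous_map (M_compactification X \<E>) euclidean (\<lambda>p. p f)"
  unfolding M_compactification_def Let_def
  using continuous_map_product_projection[OF assms, of "\<lambda>_. euclidean"]
  by (rule continuous_map_from_subtopology)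

lemma so_embedding_apply: "f \<in> so X \<E> \<Longrightarrow> so_embedding X \<E> x f = f x"
  by (simp add: so_embedding_def)

lemma so_embedding_in_M_compactification:
  fixes \<E> :: "'a rel set"
  assumes "x \<in> X"
  shows "so_embedding X \<E> x \<in>
    topspace (M_compactification X \<E> :: (('a \<Rightarrow> 'm::metric_space) \<Rightarrow> 'm) topology)"
proof -
  have "so_embedding X \<E> ` X \<subseteq> topspace (product_topology (\<lambda>_. euclidean :: 'm topology) (so X \<E>))"
    by (auto simp: so_embedding_def)
  from subsetD[OF closure_of_subset[OF this] imageI[OF assms]] show ?thesis
    unfolding topspace_M_compactification .
qed

lemma dense_so_embedding:
  "(M_compactification X \<E> :: (('a \<Rightarrow> 'm::metric_space) \<Rightarrow> 'm) topology)
      closure_of (so_embedding X \<E> ` X) = topspace (M_compactification X \<E>)"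
  (is "?H closure_of ?S = _")
proof -
  let ?P = "product_topology (\<lambda>_. euclidean :: 'm topology) (so X \<E>)"
  have "?S \<subseteq> ?P closure_of ?S"
    using so_embedding_in_M_compactification[of _ X \<E>, where 'm = 'm]
    unfolding topspace_M_compactification by (rule image_subsetI)
  then have "?P closure_of ?S \<inter> ?S = ?S"
    by blast
  then show ?thesis
    unfolding topspace_M_compactification
    by (simp add: M_compactification_def Let_def closure_of_subtopology)
qed

lemma Hausdorff_M_compactification:
  "Hausdorff_space (M_compactification X \<E> :: (('a \<Rightarrow> 'm::metric_space) \<Rightarrow> 'm) topology)"
  unfolding M_compactification_def Let_def
  by (intro Hausdorff_space_subtopology) (simp add: Hausdorff_space_product_topology)

text \<open>
  By properness of \<open>M\<close>: each coordinate of the embedded set ranges over a bounded set,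
  whose closure is compact, so Tychonoff's theorem applies.
\<close>

lemma compact_M_compactification:
  assumes M: "proper_metric TYPE('m::metric_space)"
  shows "compact_space (M_compactification X \<E> :: (('a \<Rightarrow> 'm) \<Rightarrow> 'm) topology)"
proof -
  let ?P = "product_topology (\<lambda>_. euclidean :: 'm topology) (so X \<E>)"
  let ?C = "\<Pi>\<^sub>E f\<in>so X \<E>. closure (f ` X)"
  have "compact (closure (f ` X))" if "f \<in> so X \<E>" for f :: "'a \<Rightarrow> 'm"
    using that proper_metric_compact_closure[OF M] by (auto simp: so_def)
  then have C: "compactin ?P ?C"
    by (simp add: compactin_PiE)
  have "closedin ?P ?C"
    by (simp add: closedin_product_topology)
  moreover have "so_embedding X \<E> ` X \<subseteq> ?C"
    using closure_subset by (fastforce simp: so_embedding_def)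
  ultimately have "?P closure_of (so_embedding X \<E> ` X) \<subseteq> ?C"
    by (rule closure_of_minimal[rotated])
  then have "compactin ?P (?P closure_of (so_embedding X \<E> ` X))"
    using closed_compactin[OF C] by simp
  then show ?thesis
    unfolding M_compactification_def Let_def by (rule compact_space_subtopology)
qed

text \<open>
  The indicator of a point \<open>a\<close> is constant on \<open>E[x]\<close> unless \<open>x\<close> lies in the bounded set
  \<open>E\<inverse>[a]\<close>. These functions make the embedding injective and the points of its image isolated.
\<close>

lemma indicator_in_so:
  fixes u v :: "'m::metric_space"
  assumes X: "coarse_space X \<E>" and a: "a \<in> X"
  shows "(\<lambda>x\<in>X. if x = a then u else v) \<in> so X \<E>"
proof -
  let ?f = "\<lambda>x\<in>X. if x = a then u else v"
  have "slowly_oscillating X \<E> ?f"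
    unfolding slowly_oscillating_def
  proof (intro allI impI ballI)
    fix \<epsilon> :: real and E assume \<epsilon>: "\<epsilon> > 0" and E: "E \<in> \<E>"
    have EX: "E \<subseteq> X \<times> X"
      using coarse_space_entourage[OF X E] by (auto simp: entourage_def)
    have "coarse_bounded X \<E> (E\<inverse> `` {a})"
      using coarse_space_converse[OF X E] a EX by (auto simp: coarse_bounded_def)
    moreover have "bounded (?f ` (E `` {x})) \<and> diameter (?f ` (E `` {x})) < \<epsilon>"
      if "x \<in> X - E\<inverse> `` {a}" for x
      using \<epsilon> that EX by (intro diameter_less_of_near_point[of _ _ v]) auto
    ultimately show "\<exists>B. coarse_bounded X \<E> B \<and>
        (\<forall>x\<in>X - B. bounded (?f ` (E `` {x})) \<and> diameter (?f ` (E `` {x})) < \<epsilon>)"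
      by blast
  qed
  moreover have "bounded (?f ` X)"
    by (rule bounded_subset[of "{u, v}"]) auto
  ultimately show ?thesis
    by (simp add: so_def)
qed

lemma compactification_of_M_compactification:
  assumes M: "proper_metric TYPE('m::metric_space)" and X: "coarse_space X \<E>"
  shows "compactification_of X (M_compactification X \<E> :: (('a \<Rightarrow> 'm) \<Rightarrow> 'm) topology)
    (so_embedding X \<E>)"
proof -
  let ?H = "M_compactification X \<E> :: (('a \<Rightarrow> 'm) \<Rightarrow> 'm) topology"
  let ?e = "so_embedding X \<E> :: 'a \<Rightarrow> ('a \<Rightarrow> 'm) \<Rightarrow> 'm"
  obtain u v :: 'm where uv: "u \<noteq> v"
    using M by (auto simp: proper_metric_def)
  define ind where "ind a = (\<lambda>x\<in>X. if x = a then u else v)" for a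
  have ind: "ind a \<in> so X \<E>" if "a \<in> X" for a
    unfolding ind_def using indicator_in_so[OF X that] .
  have inj: "inj_on ?e X"
  proof (rule inj_onI)
    fix a b assume ab: "a \<in> X" "b \<in> X" and "?e a = ?e b"
    then have "?e a (ind a) = ?e b (ind a)"
      by simp
    then have "ind a a = ind a b"
      unfolding so_embedding_apply[OF ind[OF ab(1)]] .
    then show "a = b"
      using ab uv by (simp add: ind_def split: if_splits)
  qed
  have isolated: "?e a \<in> isolated_points ?H" if a: "a \<in> X" for a
  proof -
    define U where "U = {p \<in> topspace ?H. p (ind a) \<noteq> v}"
    have U_eq: "U = {p \<in> topspace ?H. p (ind a) \<in> - {v}}"
      by (auto simp: U_def)
    have U: "openin ?H U"
      unfolding U_eq
      by (intro openin_continuous_map_preimage[OF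
            continuous_map_M_compactification_coordinate[OF ind[OF a]]])
        (simp add: open_Compl)
    have top: "?e a \<in> topspace ?H"
      using so_embedding_in_M_compactification[OF a] .
    have e_ind: "?e x (ind a) = (if x = a then u else v)" if "x \<in> X" for x
      unfolding so_embedding_apply[OF ind[OF a]] using that by (simp add: ind_def)
    have only: "U \<inter> ?e ` X \<subseteq> {?e a}"
    proof clarify
      fix x assume "?e x \<in> U" "x \<in> X"
      then show "?e x = ?e a"
        using e_ind[of x] by (simp add: U_def split: if_splits)
    qed
    have "closedin ?H {?e a}"
      using Hausdorff_M_compactification top by (intro closedin_Hausdorff_singleton)
    then have V: "openin ?H (U - {?e a})"
      using U by blast
    have "U - {?e a} = {}"
      using dense_so_embedding[of X \<E>, where 'm = 'm, unfolded dense_intersects_open] V only by blast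
    moreover have "?e a \<in> U"
      using top uv e_ind[OF a] by (simp add: U_def)
    ultimately have "U = {?e a}"
      by blast
    then show ?thesis
      using U top by (simp add: isolated_points_def)
  qed
  have "isolated_points ?H \<subseteq> ?e ` X"
  proof
    fix p assume "p \<in> isolated_points ?H"
    then have "openin ?H {p}"
      by (simp add: isolated_points_def)
    then show "p \<in> ?e ` X"
      using dense_so_embedding[of X \<E>, where 'm = 'm, unfolded dense_intersects_open] by blast
  qed
  then have image: "?e ` X = isolated_points ?H"
    using isolated by blast
  show ?thesis
    unfolding compactification_of_def compactification_def bij_betw_def image[symmetric]
    using compact_M_compactification[OF M] Hausdorff_M_compactification dense_so_embedding inj
    by (intro conjI refl)
qed

text \<open>
  Let \<open>F\<close> be continuous on the compactification. The pairs \<open>(p, q)\<close> at which \<open>F\<close> takes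
  \<open>\<epsilon>\<close>-distant values form a compact set off the diagonal, so finitely many coordinates \<open>f\<close>
  separate these pairs with a uniform margin. Each such \<open>f\<close> is slowly oscillating, so outside
  a bounded set no pair of \<open>E\<close>-close points of \<open>X\<close> is separated by them.
\<close>

lemma slowly_oscillating_continuous_on_M_compactification:
  fixes F :: "(('a \<Rightarrow> 'm::metric_space) \<Rightarrow> 'm) \<Rightarrow> 'm"
  assumes M: "proper_metric TYPE('m)" and X: "coarse_space X \<E>" "X \<noteq> {}"
    and F: "continuous_map (M_compactification X \<E>) euclidean F"
  shows "restrict (F \<circ> so_embedding X \<E>) X \<in> so X \<E>"
proof -
  let ?H = "M_compactification X \<E> :: (('a \<Rightarrow> 'm) \<Rightarrow> 'm) topology"
  let ?e = "so_embedding X \<E> :: 'a \<Rightarrow> ('a \<Rightarrow> 'm) \<Rightarrow> 'm"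
  let ?\<phi> = "restrict (F \<circ> ?e) X"
  have e: "?e x \<in> topspace ?H" if "x \<in> X" for x
    using so_embedding_in_M_compactification[OF that] .
  have bounded: "bounded (?\<phi> ` X)"
    using continuous_map_compact_space_bounded[OF compact_M_compactification[OF M] F, of "?e ` X"] e
    by (auto simp: image_image)
  have "slowly_oscillating X \<E> ?\<phi>"
    unfolding slowly_oscillating_def
  proof (intro allI impI ballI)
    fix \<epsilon> :: real and E assume \<epsilon>: "\<epsilon> > 0" and E: "E \<in> \<E>"
    have EX: "E \<subseteq> X \<times> X"
      using coarse_space_entourage[OF X(1) E] by (auto simp: entourage_def)
    let ?HH = "prod_topology ?H ?H"
    have cont: "continuous_map ?HH euclideanreal (\<lambda>w. dist (G (fst w)) (G (snd w)))"
      if "continuous_map ?H euclidean G" for G :: "_ \<Rightarrow> 'm"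
      using continuous_map_dist[OF
          continuous_map_compose[OF continuous_map_fst that]
          continuous_map_compose[OF continuous_map_snd that]]
      by (simp add: comp_def)
    define D where "D = {w \<in> topspace ?HH. dist (F (fst w)) (F (snd w)) \<in> {\<epsilon> / 3..}}"
    have "compact_space ?HH"
      using compact_M_compactification[OF M, of X \<E>] by (simp add: compact_space_prod_topology)
    moreover have "closedin ?HH D"
      unfolding D_def by (intro closedin_continuous_map_preimage[OF cont[OF F]]) simp
    ultimately have D: "compactin ?HH D"
      by (rule closedin_compact_space)
    define W where "W f n = {w \<in> topspace ?HH. dist (fst w f) (snd w f) \<in> {inverse (Suc n)<..}}"
      for f :: "'a \<Rightarrow> 'm" and n :: nat
    have W: "openin ?HH (W f n)" if "f \<in> so X \<E>" for f n
      unfolding W_def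
      by (intro openin_continuous_map_preimage[OF
            cont[OF continuous_map_M_compactification_coordinate[OF that]]]) simp
    let ?\<W> = "(\<lambda>(f, n). W f n) ` (so X \<E> \<times> UNIV)"
    have cover: "D \<subseteq> \<Union>?\<W>"
    proof
      fix w assume "w \<in> D"
      then have w: "fst w \<in> topspace ?H" "snd w \<in> topspace ?H"
        and "dist (F (fst w)) (F (snd w)) \<ge> \<epsilon> / 3"
        by (auto simp: D_def)
      then have ne: "fst w \<noteq> snd w"
        using \<epsilon> by auto
      have "topspace ?H \<subseteq> extensional (so X \<E>)"
        unfolding M_compactification_def Let_def by (auto simp: PiE_def)
      then obtain f where f: "f \<in> so X \<E>" "fst w f \<noteq> snd w f"
        using w ne extensionalityI[of "fst w" "so X \<E>" "snd w"] by blast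
      then obtain n where "inverse (Suc n) < dist (fst w f) (snd w f)"
        using reals_Archimedean[of "dist (fst w f) (snd w f)"] by auto
      then have "w \<in> W f n"
        using \<open>w \<in> D\<close> by (simp add: W_def D_def)
      then show "w \<in> \<Union>?\<W>"
        using f(1) by blast
    qed
    have "openin ?HH U" if "U \<in> ?\<W>" for U
      using that W by auto
    from compactinD[OF D this cover]
    obtain \<F> where \<F>: "finite \<F>" "\<F> \<subseteq> ?\<W>" "D \<subseteq> \<Union>\<F>"
      by metis
    obtain I where I: "I \<subseteq> so X \<E> \<times> UNIV" "finite I" "\<F> = (\<lambda>(f, n). W f n) ` I"
      using finite_subset_image[OF \<F>(1,2)] by metis
    have "\<exists>B. coarse_bounded X \<E> B \<and> (\<forall>x\<in>X - B. bounded (fst i ` (E `` {x})) \<and>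
        diameter (fst i ` (E `` {x})) < inverse (Suc (snd i)))" if "i \<in> I" for i
    proof -
      have "slowly_oscillating X \<E> (fst i)"
        using I(1) that by (auto simp: so_def)
      moreover have "inverse (real (Suc (snd i))) > 0"
        by simp
      ultimately show ?thesis
        using E unfolding slowly_oscillating_def by blast
    qed
    then obtain B where B: "\<And>i. i \<in> I \<Longrightarrow> coarse_bounded X \<E> (B i)"
      "\<And>i x. i \<in> I \<Longrightarrow> x \<in> X - B i \<Longrightarrow> bounded (fst i ` (E `` {x})) \<and>
        diameter (fst i ` (E `` {x})) < inverse (Suc (snd i))"
      by metis
    have "bounded (?\<phi> ` (E `` {x})) \<and> diameter (?\<phi> ` (E `` {x})) < \<epsilon>"
      if x: "x \<in> X - (\<Union>i\<in>I. B i)" for x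
    proof (rule diameter_less_of_near_point[OF \<epsilon>])
      fix t assume "t \<in> ?\<phi> ` (E `` {x})"
      then obtain y where y: "(x, y) \<in> E" "y \<in> X" "t = F (?e y)"
        using EX by auto
      have "(?e x, ?e y) \<notin> W f n" if i: "(f, n) \<in> I" for f n
      proof -
        have f: "f \<in> so X \<E>"
          using i I(1) by auto
        have "(x, x) \<in> E"
          using entourage_refl[OF coarse_space_entourage[OF X(1) E]] x by blast
        moreover have "x \<in> X - B (f, n)"
          using x i by blast
        then have "bounded (f ` (E `` {x}))" "diameter (f ` (E `` {x})) < inverse (Suc n)"
          using B(2)[OF i, of x] by auto
        ultimately have "dist (f x) (f y) < inverse (Suc n)"
          using diameter_bounded_bound[of "f ` (E `` {x})" "f x" "f y"] y(1) by fastforce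
        then show ?thesis
          by (simp add: W_def so_embedding_apply[OF f])
      qed
      then have "(?e x, ?e y) \<notin> D"
        using \<F>(3) I(3) by auto
      then show "dist (F (?e x)) t \<le> \<epsilon> / 3"
        using e x y by (auto simp: D_def)
    qed
    moreover have "coarse_bounded X \<E> (\<Union>i\<in>I. B i)"
      using X I(2) B(1) by (rule coarse_bounded_UN)
    ultimately show "\<exists>B. coarse_bounded X \<E> B \<and>
        (\<forall>x\<in>X - B. bounded (?\<phi> ` (E `` {x})) \<and> diameter (?\<phi> ` (E `` {x})) < \<epsilon>)"
      by (intro exI[of _ "\<Union>i\<in>I. B i"] conjI[OF _ ballI])
  qed
  then show ?thesis
    using bounded by (simp add: so_def)
qed

theorem uc_M_compactification:
  assumes M: "proper_metric TYPE('m::metric_space)" and X: "coarse_space X \<E>" "X \<noteq> {}"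
  shows "uc X (M_compactification X \<E> :: (('a \<Rightarrow> 'm) \<Rightarrow> 'm) topology) (so_embedding X \<E>) =
    (so X \<E> :: ('a \<Rightarrow> 'm) set)"
  (is "uc X ?H ?e = ?so")
proof
  show "uc X ?H ?e \<subseteq> ?so"
    using slowly_oscillating_continuous_on_M_compactification[OF M X] by (auto simp: uc_def)
  show "?so \<subseteq> uc X ?H ?e"
  proof
    fix f assume f: "f \<in> ?so"
    have "restrict ((\<lambda>p. p f) \<circ> ?e) X = restrict f X"
      by (rule ext) (simp add: so_embedding_apply[OF f])
    also have "\<dots> = f"
      using f by (simp add: so_def extensional_restrict)
    finally have "f = restrict ((\<lambda>p. p f) \<circ> ?e) X" ..
    then show "f \<in> uc X ?H ?e"
      using continuous_map_M_compactification_coordinate[OF f] unfolding uc_def mem_Collect_eq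
      by (intro exI conjI)
  qed
qed

section \<open>Slow oscillation in the permutation coarse space\<close>

lemma homeo_fixing_maps_to:
  assumes g: "g \<in> homeo_fixing K X" and x: "x \<in> X" and X: "X \<subseteq> topspace K"
  shows "g x \<in> X"
proof (rule ccontr)
  assume gx: "g x \<notin> X"
  have hom: "homeomorphic_map K K g"
    using g by (simp add: homeo_fixing_def)
  have "g x \<in> topspace K"
    using homeomorphic_imp_surjective_map[OF hom] x X by blast
  then have "g (g x) = g x"
    using g gx by (auto simp: homeo_fixing_def)
  moreover have "inj_on g (topspace K)"
    using homeomorphic_imp_injective_map[OF hom] .
  ultimately have "g x = x"
    using \<open>g x \<in> topspace K\<close> x X by (auto dest: inj_onD)
  then show False
    using gx x by simp
qed

lemma isolated_points_subset: "isolated_points K \<subseteq> topspace K"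
  by (auto simp: isolated_points_def)

lemma orbit_entourage_in_perm_coarse:
  assumes "finite F" and "F \<subseteq> perm_group X K"
  shows "orbit_entourage X F \<in> perm_coarse X K"
  using assms by (auto simp: perm_coarse_def entourage_def orbit_entourage_def)

text \<open>
  Finite sets are bounded because transpositions of isolated points belong to the permutation group.
\<close>

lemma coarse_bounded_perm_coarse_iff:
  assumes K: "Hausdorff_space K" and X: "X = isolated_points K" "X \<noteq> {}"
  shows "coarse_bounded X (perm_coarse X K) B \<longleftrightarrow> finite B \<and> B \<subseteq> X"
proof
  assume "coarse_bounded X (perm_coarse X K) B"
  then obtain E x where E: "E \<in> perm_coarse X K" "B \<subseteq> E `` {x}" and "B \<subseteq> X"
    by (auto simp: coarse_bounded_def)
  then obtain F where F: "finite F" "E \<subseteq> orbit_entourage X F"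
    by (auto simp: perm_coarse_def)
  have "B \<subseteq> insert x ((\<lambda>g. g x) ` F)"
    using E(2) F(2) by (auto simp: orbit_entourage_def)
  then show "finite B \<and> B \<subseteq> X"
    using F(1) \<open>B \<subseteq> X\<close> finite_subset by blast
next
  assume B: "finite B \<and> B \<subseteq> X"
  obtain a where a: "a \<in> X"
    using X(2) by blast
  define t where
    "t b = restrict (restrict (Transposition.transpose a b) (topspace K)) X" for b
  have "t b \<in> perm_group X K" if "b \<in> B" for b
    unfolding t_def perm_group_def
    using transpose_homeo_fixing[OF K, of a b] that a B X(1) by blast
  then have "orbit_entourage X (t ` B) \<in> perm_coarse X K"
    using B by (intro orbit_entourage_in_perm_coarse) auto
  moreover have "B \<subseteq> orbit_entourage X (t ` B) `` {a}"
  proof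
    fix b assume b: "b \<in> B"
    have "t b a = b"
      using a X(1) isolated_points_subset[of K] by (auto simp: t_def)
    then have "\<exists>g. b = g a \<and> g \<in> t ` B"
      using b by (intro exI[of _ "t b"]) simp
    then show "b \<in> orbit_entourage X (t ` B) `` {a}"
      using a b B by (auto simp: orbit_entourage_def)
  qed
  ultimately show "coarse_bounded X (perm_coarse X K) B"
    using a B by (auto simp: coarse_bounded_def)
qed

lemma slowly_oscillating_perm_coarse_iff:
  fixes \<phi> :: "'a \<Rightarrow> 'm::metric_space"
  assumes K: "Hausdorff_space K" and X: "X = isolated_points K" "X \<noteq> {}"
  shows "slowly_oscillating X (perm_coarse X K) \<phi> \<longleftrightarrow>
    (\<forall>g\<in>homeo_fixing K X. \<forall>\<epsilon>>0. finite {x \<in> X. dist (\<phi> (g x)) (\<phi> x) \<ge> \<epsilon>})"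
    (is "?slow \<longleftrightarrow> ?fin")
proof
  assume slow: ?slow
  show ?fin
  proof (intro ballI allI impI)
    fix g and \<epsilon> :: real assume g: "g \<in> homeo_fixing K X" and \<epsilon>: "\<epsilon> > 0"
    define E where "E = orbit_entourage X {restrict g X}"
    have "E \<in> perm_coarse X K"
      unfolding E_def using g by (intro orbit_entourage_in_perm_coarse) (auto simp: perm_group_def)
    then obtain B where B: "coarse_bounded X (perm_coarse X K) B"
      "\<And>x. x \<in> X - B \<Longrightarrow> bounded (\<phi> ` (E `` {x})) \<and> diameter (\<phi> ` (E `` {x})) < \<epsilon>"
      using slow \<epsilon> unfolding slowly_oscillating_def by blast
    have "dist (\<phi> (g x)) (\<phi> x) < \<epsilon>" if x: "x \<in> X - B" for x
    proof -
      have "g x \<in> X"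
        using homeo_fixing_maps_to[OF g _ isolated_points_subset[of K, folded X(1)]] x by blast
      then have "g x \<in> E `` {x}" "x \<in> E `` {x}"
        using x by (auto simp: E_def orbit_entourage_def)
      then show ?thesis
        using diameter_bounded_bound[of "\<phi> ` (E `` {x})" "\<phi> (g x)" "\<phi> x"] B(2)[OF x] by fastforce
    qed
    then have "{x \<in> X. dist (\<phi> (g x)) (\<phi> x) \<ge> \<epsilon>} \<subseteq> B"
      by fastforce
    then show "finite {x \<in> X. dist (\<phi> (g x)) (\<phi> x) \<ge> \<epsilon>}"
      using B(1) coarse_bounded_perm_coarse_iff[OF assms] finite_subset by blast
  qed
next
  assume fin: ?fin
  show ?slow
    unfolding slowly_oscillating_def
  proof (intro allI impI ballI)
    fix \<epsilon> :: real and E assume \<epsilon>: "\<epsilon> > 0" and "E \<in> perm_coarse X K"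
    then obtain F where F: "finite F" "F \<subseteq> perm_group X K" "E \<subseteq> orbit_entourage X F"
      by (auto simp: perm_coarse_def)
    define B where "B = (\<Union>h\<in>F. {x \<in> X. dist (\<phi> (h x)) (\<phi> x) \<ge> \<epsilon> / 3})"
    have "finite {x \<in> X. dist (\<phi> (h x)) (\<phi> x) \<ge> \<epsilon> / 3}" if h: "h \<in> F" for h
    proof -
      obtain g where g: "g \<in> homeo_fixing K X" "h = restrict g X"
        using h F(2) unfolding perm_group_def by blast
      have "{x \<in> X. dist (\<phi> (h x)) (\<phi> x) \<ge> \<epsilon> / 3} = {x \<in> X. dist (\<phi> (g x)) (\<phi> x) \<ge> \<epsilon> / 3}"
        using g(2) by auto
      moreover have "\<epsilon> / 3 > 0"
        using \<epsilon> by simp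
      ultimately show ?thesis
        using fin g(1) by metis
    qed
    then have "coarse_bounded X (perm_coarse X K) B"
      unfolding coarse_bounded_perm_coarse_iff[OF assms] using F(1) by (auto simp: B_def)
    moreover have "bounded (\<phi> ` (E `` {x})) \<and> diameter (\<phi> ` (E `` {x})) < \<epsilon>"
      if x: "x \<in> X - B" for x
    proof (rule diameter_less_of_near_point[OF \<epsilon>])
      fix t assume "t \<in> \<phi> ` (E `` {x})"
      then obtain y where y: "t = \<phi> y" "y = x \<or> (\<exists>h\<in>F. y = h x)"
        using F(3) by (auto simp: orbit_entourage_def)
      show "dist (\<phi> x) t \<le> \<epsilon> / 3"
        using y x \<epsilon> by (auto simp: B_def dist_commute not_le intro: less_imp_le)
    qed
    ultimately show "\<exists>B. coarse_bounded X (perm_coarse X K) B \<and>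
        (\<forall>x\<in>X - B. bounded (\<phi> ` (E `` {x})) \<and> diameter (\<phi> ` (E `` {x})) < \<epsilon>)"
      by blast
  qed
qed

lemma finite_closedin_isolated_points:
  assumes "compact_space K" and "closedin K S" and "S \<subseteq> isolated_points K"
  shows "finite S"
proof -
  have "compactin K S"
    using assms(1,2) by (rule closedin_compact_space)
  then obtain \<F> where "finite \<F>" "\<F> \<subseteq> (\<lambda>x. {x}) ` S" "S \<subseteq> \<Union>\<F>"
    using compactinD[of K S "(\<lambda>x. {x}) ` S"] assms(3) by (auto simp: isolated_points_def)
  moreover from this have "finite (\<Union>\<F>)"
    by (intro finite_Union) auto
  ultimately show ?thesis
    by (blast intro: finite_subset)
qed

text \<open>
  Let \<open>f\<close> be continuous on \<open>K\<close> and let \<open>g\<close> belong to the permutation group. The displacement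
  \<open>dist (f (g y)) (f y)\<close> is continuous on \<open>K\<close> and vanishes off \<open>X\<close>, so for \<open>\<epsilon> > 0\<close> it is at
  least \<open>\<epsilon>\<close> only on a closed set of isolated points, and such a set is finite.
\<close>

lemma uc_subset_so_perm_coarse:
  assumes K: "compactification K" and X: "X = isolated_points K" "X \<noteq> {}"
  shows "uc X K (\<lambda>x. x) \<subseteq> (so X (perm_coarse X K) :: ('a \<Rightarrow> 'm::metric_space) set)"
proof
  have comp: "compact_space K" and Haus: "Hausdorff_space K"
    using K by (auto simp: compactification_def)
  have XK: "X \<subseteq> topspace K"
    using isolated_points_subset[of K] X(1) by simp
  fix \<phi> :: "'a \<Rightarrow> 'm" assume "\<phi> \<in> uc X K (\<lambda>x. x)"
  then obtain f where f: "continuous_map K euclidean f" and \<phi>: "\<phi> = restrict f X"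
    by (auto simp: uc_def comp_def)
  have "finite {x \<in> X. dist (\<phi> (g x)) (\<phi> x) \<ge> \<epsilon>}"
    if g: "g \<in> homeo_fixing K X" and \<epsilon>: "\<epsilon> > 0" for g and \<epsilon> :: real
  proof -
    define S where "S = {x \<in> topspace K. dist (f (g x)) (f x) \<in> {\<epsilon>..}}"
    have "continuous_map K K g"
      using g homeomorphic_imp_continuous_map by (auto simp: homeo_fixing_def)
    then have "continuous_map K euclidean (f \<circ> g)"
      using f by (rule continuous_map_compose)
    then have "closedin K S"
      unfolding S_def using continuous_map_dist[OF _ f, of "f \<circ> g"]
      by (intro closedin_continuous_map_preimage[where Y = euclideanreal]) (simp_all add: comp_def)
    moreover have "S \<subseteq> isolated_points K"
      using g \<epsilon> X(1) by (fastforce simp: S_def homeo_fixing_def)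
    ultimately have "finite S"
      using finite_closedin_isolated_points[OF comp] by blast
    moreover have "{x \<in> X. dist (\<phi> (g x)) (\<phi> x) \<ge> \<epsilon>} \<subseteq> S"
      using XK homeo_fixing_maps_to[OF g _ XK] by (auto simp: S_def \<phi>)
    ultimately show ?thesis
      by (rule finite_subset[rotated])
  qed
  then have "slowly_oscillating X (perm_coarse X K) \<phi>"
    unfolding slowly_oscillating_perm_coarse_iff[OF Haus X] by blast
  moreover have "bounded (\<phi> ` X)"
    using continuous_map_compact_space_bounded[OF comp f XK] by (simp add: \<phi>)
  ultimately show "\<phi> \<in> so X (perm_coarse X K)"
    by (simp add: so_def \<phi>)
qed

section \<open>Oscillation and continuous extension\<close>

lemma osc_le_0_iff:
  fixes \<phi> :: "'a \<Rightarrow> 'm::metric_space"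
  assumes bounded: "bounded (\<phi> ` isolated_points K)" and z: "z \<in> topspace K"
  shows "osc K \<phi> z \<le> 0 \<longleftrightarrow>
    (\<forall>\<epsilon>>0. \<exists>U. openin K U \<and> z \<in> U \<and> diameter (\<phi> ` (isolated_points K \<inter> U)) < \<epsilon>)"
proof -
  let ?D = "{diameter (\<phi> ` (isolated_points K \<inter> U)) | U. openin K U \<and> z \<in> U}"
  have "bounded (\<phi> ` (isolated_points K \<inter> U))" for U
    using bounded by (rule bounded_subset) blast
  then have "bdd_below ?D"
    using diameter_ge_0 by (intro bdd_belowI[of _ 0]) blast
  moreover have "?D \<noteq> {}"
    using z by blast
  ultimately have less: "Inf ?D < \<epsilon> \<longleftrightarrow> (\<exists>d\<in>?D. d < \<epsilon>)" for \<epsilon>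
    by (intro cInf_less_iff)
  have "i \<le> 0 \<longleftrightarrow> (\<forall>\<epsilon>>0. i < \<epsilon>)" for i :: real
    by (meson dense_ge le_less_trans less_imp_le)
  then have "osc K \<phi> z \<le> 0 \<longleftrightarrow> (\<forall>\<epsilon>>0. Inf ?D < \<epsilon>)"
    unfolding osc_def .
  also have "\<dots> \<longleftrightarrow> (\<forall>\<epsilon>>0. \<exists>U. openin K U \<and> z \<in> U \<and>
      diameter (\<phi> ` (isolated_points K \<inter> U)) < \<epsilon>)"
    unfolding less by blast
  finally show ?thesis .
qed

text \<open>
  For vanishing oscillation, the value of the extension at \<open>z\<close> is a common point of the closures of
  the sets \<open>\<phi> ` (X \<inter> U)\<close>, where \<open>U\<close> runs over the open neighbourhoods of \<open>z\<close>. Such a point exists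
  because \<open>X\<close> is dense and these closures lie in a compact set. If the closure for \<open>U\<close> has diameter
  less than \<open>\<epsilon>\<close>, then it contains the chosen values at all points of \<open>U\<close>, so the extension is
  continuous.
\<close>

lemma restrict_in_uc_iff_osc_le_0:
  fixes \<phi> :: "'a \<Rightarrow> 'm::metric_space"
  assumes M: "proper_metric TYPE('m)" and K: "K closure_of isolated_points K = topspace K"
    and X: "X = isolated_points K" and bounded: "bounded (\<phi> ` X)"
  shows "restrict \<phi> X \<in> uc X K (\<lambda>x. x) \<longleftrightarrow> (\<forall>z\<in>topspace K. osc K \<phi> z \<le> 0)"
proof
  have osc: "osc K \<phi> z \<le> 0 \<longleftrightarrow>
      (\<forall>\<epsilon>>0. \<exists>U. openin K U \<and> z \<in> U \<and> diameter (\<phi> ` (X \<inter> U)) < \<epsilon>)" if "z \<in> topspace K" for z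
    using osc_le_0_iff[of \<phi> K z] bounded that X by simp
  {
    assume "restrict \<phi> X \<in> uc X K (\<lambda>x. x)"
    then obtain f where f: "continuous_map K euclidean f" and "restrict \<phi> X = restrict f X"
      by (auto simp: uc_def comp_def)
    then have eq: "\<phi> x = f x" if "x \<in> X" for x
      using that by (metis restrict_apply')
    show "\<forall>z\<in>topspace K. osc K \<phi> z \<le> 0"
    proof
      fix z assume z: "z \<in> topspace K"
      have "\<exists>U. openin K U \<and> z \<in> U \<and> diameter (\<phi> ` (X \<inter> U)) < \<epsilon>" if "\<epsilon> > 0" for \<epsilon> :: real
      proof -
        have "\<epsilon> / 3 > 0"
          using that by simp
        then obtain U where U: "openin K U" "z \<in> U" "\<And>y. y \<in> U \<Longrightarrow> dist (f z) (f y) < \<epsilon> / 3"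
          using f[unfolded continuous_map_metric_iff, rule_format, OF z] by meson
        have "bounded (\<phi> ` (X \<inter> U)) \<and> diameter (\<phi> ` (X \<inter> U)) < \<epsilon>"
        proof (rule diameter_less_of_near_point[OF that])
          fix t assume "t \<in> \<phi> ` (X \<inter> U)"
          then obtain y where "y \<in> X" "y \<in> U" "t = \<phi> y"
            by blast
          then show "dist (f z) t \<le> \<epsilon> / 3"
            using U(3)[of y] eq[of y] by simp
        qed
        then show ?thesis
          using U(1,2) by blast
      qed
      then show "osc K \<phi> z \<le> 0"
        using osc[OF z] by blast
    qed
  }
  assume osc0: "\<forall>z\<in>topspace K. osc K \<phi> z \<le> 0"
  have "\<exists>m. \<forall>U. openin K U \<and> z \<in> U \<longrightarrow> m \<in> closure (\<phi> ` (X \<inter> U))" if z: "z \<in> topspace K" for z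
  proof -
    let ?I = "{U. openin K U \<and> z \<in> U}"
    have "closure (\<phi> ` X) \<inter> (\<Inter>U\<in>?I. closure (\<phi> ` (X \<inter> U))) \<noteq> {}"
    proof (rule compact_imp_fip_image)
      show "compact (closure (\<phi> ` X))"
        using proper_metric_compact_closure[OF M bounded] .
      fix J assume J: "finite J" "J \<subseteq> ?I"
      define V where "V = topspace K \<inter> \<Inter>J"
      have "openin K V"
      proof (cases "J = {}")
        case False
        then have "openin K (\<Inter>J)"
          using J by (intro openin_Inter) auto
        then show ?thesis
          by (auto simp: V_def)
      qed (simp add: V_def)
      moreover have "z \<in> V"
        using z J by (auto simp: V_def)
      ultimately obtain x where "x \<in> X" "x \<in> V"
        using K[unfolded dense_intersects_open] X by blast
      then have "\<phi> x \<in> \<phi> ` X" "\<And>U. U \<in> J \<Longrightarrow> \<phi> x \<in> \<phi> ` (X \<inter> U)"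
        by (auto simp: V_def)
      then have "\<phi> x \<in> closure (\<phi> ` X) \<inter> (\<Inter>U\<in>J. closure (\<phi> ` (X \<inter> U)))"
        using closure_subset by blast
      then show "closure (\<phi> ` X) \<inter> (\<Inter>U\<in>J. closure (\<phi> ` (X \<inter> U))) \<noteq> {}"
        by blast
    qed simp
    then show ?thesis
      by blast
  qed
  then obtain f where f: "\<And>z U. z \<in> topspace K \<Longrightarrow> openin K U \<Longrightarrow> z \<in> U \<Longrightarrow>
      f z \<in> closure (\<phi> ` (X \<inter> U))"
    by metis
  have near: "dist s t < \<epsilon>"
    if "diameter (\<phi> ` (X \<inter> U)) < \<epsilon>" "s \<in> closure (\<phi> ` (X \<inter> U))" "t \<in> closure (\<phi> ` (X \<inter> U))"
    for U \<epsilon> s t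
  proof -
    have b: "bounded (\<phi> ` (X \<inter> U))"
      using bounded by (rule bounded_subset) blast
    then show ?thesis
      using diameter_bounded_bound[OF bounded_closure[OF b] that(2,3)] diameter_closure[OF b] that(1)
      by simp
  qed
  have "continuous_map K euclidean f"
    unfolding continuous_map_metric_iff
  proof (intro ballI allI impI)
    fix z and \<epsilon> :: real assume z: "z \<in> topspace K" and "\<epsilon> > 0"
    then obtain U where U: "openin K U" "z \<in> U" "diameter (\<phi> ` (X \<inter> U)) < \<epsilon>"
      using osc0 osc[OF z] by blast
    have "dist (f z) (f w) < \<epsilon>" if "w \<in> U" for w
      using near[OF U(3) f[OF z U(1,2)] f[OF _ U(1) that]] openin_subset[OF U(1)] that by blast
    then show "\<exists>U. openin K U \<and> z \<in> U \<and> (\<forall>w\<in>U. dist (f z) (f w) < \<epsilon>)"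
      using U by blast
  qed
  moreover have "f x = \<phi> x" if x: "x \<in> X" for x
  proof -
    have "f x \<in> closure (\<phi> ` (X \<inter> {x}))"
      using x X by (intro f) (auto simp: isolated_points_def)
    moreover have "X \<inter> {x} = {x}"
      using x by blast
    ultimately show ?thesis
      by simp
  qed
  then have "restrict \<phi> X = restrict (f \<circ> (\<lambda>x. x)) X"
    by (auto simp: restrict_def)
  ultimately show "restrict \<phi> X \<in> uc X K (\<lambda>x. x)"
    by (auto simp: uc_def)
qed

section \<open>Softness\<close>

text \<open>
  The contrapositive of softness says that a bounded \<open>\<phi>\<close> which every \<open>g\<close> displaces by at least \<open>\<epsilon>\<close>
  only finitely often has no point of positive oscillation. Its hypothesis is slow oscillation and its
  conclusion is continuous extendability. Both depend only on the restriction of \<open>\<phi>\<close> to \<open>X\<close>,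
  because \<open>g\<close> maps \<open>X\<close> into itself.
\<close>

lemma M_soft_iff_so_subset_uc:
  assumes M: "proper_metric TYPE('m::metric_space)" and K: "compactification K"
    and X: "X = isolated_points K" "X \<noteq> {}"
  shows "M_soft TYPE('m) K \<longleftrightarrow>
    (so X (perm_coarse X K) :: ('a \<Rightarrow> 'm) set) \<subseteq> uc X K (\<lambda>x. x)"
proof -
  have Haus: "Hausdorff_space K" and dense: "K closure_of isolated_points K = topspace K"
    using K by (auto simp: compactification_def)
  have XK: "X \<subseteq> topspace K"
    using isolated_points_subset[of K] X(1) by simp
  have so_iff: "restrict \<phi> X \<in> so X (perm_coarse X K) \<longleftrightarrow>
      (\<forall>g\<in>homeo_fixing K X. \<forall>\<epsilon>>0. finite {x \<in> X. dist (\<phi> (g x)) (\<phi> x) \<ge> \<epsilon>})"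
    if "bounded (\<phi> ` X)" for \<phi> :: "'a \<Rightarrow> 'm"
  proof -
    have "{x \<in> X. dist (restrict \<phi> X (g x)) (restrict \<phi> X x) \<ge> \<epsilon>} =
        {x \<in> X. dist (\<phi> (g x)) (\<phi> x) \<ge> \<epsilon>}" if "g \<in> homeo_fixing K X" for g \<epsilon>
      using homeo_fixing_maps_to[OF that _ XK] by auto
    moreover have "restrict \<phi> X \<in> so X (perm_coarse X K) \<longleftrightarrow>
        slowly_oscillating X (perm_coarse X K) (restrict \<phi> X)"
      using that by (simp add: so_def)
    ultimately show ?thesis
      unfolding slowly_oscillating_perm_coarse_iff[OF Haus X] by simp
  qed
  have "M_soft TYPE('m) K \<longleftrightarrow> (\<forall>\<phi> :: 'a \<Rightarrow> 'm. bounded (\<phi> ` X) \<longrightarrow>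
      (\<forall>g\<in>homeo_fixing K X. \<forall>\<epsilon>>0. finite {x \<in> X. dist (\<phi> (g x)) (\<phi> x) \<ge> \<epsilon>}) \<longrightarrow>
      (\<forall>z\<in>topspace K. osc K \<phi> z \<le> 0))"
    unfolding M_soft_def X(1)[symmetric] using K by (auto simp: not_less[symmetric])
  also have "\<dots> \<longleftrightarrow> (\<forall>\<phi> :: 'a \<Rightarrow> 'm. bounded (\<phi> ` X) \<longrightarrow>
      restrict \<phi> X \<in> so X (perm_coarse X K) \<longrightarrow> restrict \<phi> X \<in> uc X K (\<lambda>x. x))"
    by (simp only: so_iff restrict_in_uc_iff_osc_le_0[OF M dense X(1)] cong: imp_cong)
  also have "\<dots> \<longleftrightarrow> (so X (perm_coarse X K) :: ('a \<Rightarrow> 'm) set) \<subseteq> uc X K (\<lambda>x. x)"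
    (is "?all \<longleftrightarrow> ?sub")
  proof
    assume all: ?all
    show ?sub
    proof
      fix \<phi> :: "'a \<Rightarrow> 'm" assume \<phi>: "\<phi> \<in> so X (perm_coarse X K)"
      then have "bounded (\<phi> ` X)" and eq: "restrict \<phi> X = \<phi>"
        by (simp_all add: so_def extensional_restrict)
      then show "\<phi> \<in> uc X K (\<lambda>x. x)"
        using all[rule_format, of \<phi>] \<phi> unfolding eq by simp
    qed
  next
    assume ?sub
    then show ?all
      by (intro allI impI) (rule subsetD)
  qed
  finally show ?thesis .
qed

lemma uc_empty:
  fixes T :: "'t topology" and e :: "'x \<Rightarrow> 't"
  shows "(uc {} T e :: ('x \<Rightarrow> 'm::metric_space) set) = {\<lambda>_. undefined}"
proof
  show "uc {} T e \<subseteq> {\<lambda>_. undefined :: 'm}"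
    by (auto simp: uc_def)
  \<comment> \<open>Some continuous map is needed for the other inclusion; a constant one will do.\<close>
  define c :: "'t \<Rightarrow> 'm" where "c = (\<lambda>_. undefined)"
  have c: "continuous_map T euclidean c"
    by (simp add: c_def)
  have "restrict (c \<circ> e) {} \<in> uc {} T e"
    unfolding uc_def by (intro CollectI exI[of _ c] conjI refl c)
  moreover have "restrict (c \<circ> e) {} = (\<lambda>_. undefined)"
    by (simp add: restrict_def)
  ultimately show "{\<lambda>_. undefined :: 'm} \<subseteq> uc {} T e"
    by simp
qed

theorem theorem6p3:
  fixes K :: "'a topology" and X :: "'a set"
  assumes "proper_metric TYPE('m::metric_space)"
    and "compactification K"
    and "X = isolated_points K"
  shows "M_equivalent TYPE('m) X
           K (\<lambda>x. x)
           (M_compactification X (perm_coarse X K) :: (('a \<Rightarrow> 'm) \<Rightarrow> 'm) topology)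
           (so_embedding X (perm_coarse X K))
         \<longleftrightarrow> M_soft TYPE('m) K"
proof -
  let ?\<E> = "perm_coarse X K"
  let ?H = "M_compactification X ?\<E> :: (('a \<Rightarrow> 'm) \<Rightarrow> 'm) topology"
  have coarse: "coarse_space X ?\<E>"
    using coarse_space_perm_coarse[of K] assms(2,3) by (simp add: compactification_def)
  have "compactification_of X K (\<lambda>x. x)"
    using assms(2,3) by (simp add: compactification_of_def bij_betw_def)
  then have equiv: "M_equivalent TYPE('m) X K (\<lambda>x. x) ?H (so_embedding X ?\<E>) \<longleftrightarrow>
      (uc X K (\<lambda>x. x) :: ('a \<Rightarrow> 'm) set) = uc X ?H (so_embedding X ?\<E>)"
    using compactification_of_M_compactification[OF assms(1) coarse]
    by (simp add: M_equivalent_def)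
  show ?thesis
  proof (cases "X = {}")
    case True
    then have "topspace K = {}"
      using assms(2,3) by (auto simp: compactification_def)
    then have "M_soft TYPE('m) K"
      using assms(2) by (simp add: M_soft_def)
    then show ?thesis
      unfolding equiv using True by (simp add: uc_empty)
  next
    case False
    have "(uc X K (\<lambda>x. x) :: ('a \<Rightarrow> 'm) set) = uc X ?H (so_embedding X ?\<E>) \<longleftrightarrow>
        (so X ?\<E> :: ('a \<Rightarrow> 'm) set) \<subseteq> uc X K (\<lambda>x. x)"
      unfolding uc_M_compactification[OF assms(1) coarse False]
      using uc_subset_so_perm_coarse[OF assms(2,3) False, where 'm = 'm] by blast
    then show ?thesis
      unfolding equiv M_soft_iff_so_subset_uc[OF assms False] .
  qed
qed

end
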